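(* Let $L$ be a bounded lattice equipped with an antitone unary operation $\neg$ with $\neg1=0$, a multiplicative unary operation $\Box$, and an additive unary operation $\Diamond$. Define $X$ to be the set of pairs $(F,I)$ with $F$ a filter in $L$, $I$ an ideal in $L$, and $\{\neg a\mid a\in F\}\subseteq I$; $(F,I)\vartriangleleft(F',I')$ iff $I\cap F'=\varnothing$; $(F,I)R(F',I')$ iff for all $a\in L$, $\Box a\in F$ implies $a\in F'$; $(F,I)Q(F',I')$ iff for all $a\in L$, $\Diamond a\in I$ implies $a\in I'$. Then $(X,\vartriangleleft,R,Q)$ is an additive modal frame; $(L,\neg,\Box,\Diamond)$ embeds into $(\mathfrak{L}(X,\vartriangleleft),\neg_\vartriangleleft,\Box_R,\Diamond_Q)$; and $(L,\neg,\Box,\Diamond)$ is isomorphic to the subalgebra of $(\mathfrak{L}(X,\vartriangleleft),\neg_\vartriangleleft,\Box_R,\Diamond_Q)$ consisting of those $c_\vartriangleleft$-fixpoints that are compact open in the topology on $X$ generated by $\{\widehat{a}\mid a\in L\}$, where $\widehat{a}=\{(F,I)\in X\mid a\in F\}$.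
   Context: Multiplicative: $\Box(a\wedge b)=\Box a\wedge\Box b$ and $\Box1=1$ (preserves finite meets); additive: $\Diamond(a\vee b)=\Diamond a\vee\Diamond b$ and $\Diamond0=0$ (preserves finite joins). A modal frame is a tuple $(X,\vartriangleleft,R,Q)$ with $X$ nonempty and binary relations such that for all $x,y,z$: if $xRy$ and $z\vartriangleleft y$, then there is $x'\vartriangleleft x$ such that for all $x''$ with $x'\vartriangleleft x''$ there is $y''$ with $x''Ry''$ and $z\vartriangleleft y''$. It is additive if for all $x,y,z$: if $xQy$ and $y\vartriangleleft z$, then there is $x'$ with $x\vartriangleleft x'$ such that for all $x''\vartriangleleft x'$ there is $y''$ with $x''Qy''$ and $y''\vartriangleleft z$. ($u\vartriangleright v$ means $v\vartriangleleft u$.) $c_\vartriangleleft(A)=\{x\mid \forall y\vartriangleleft x\ \exists z\vartriangleright y: z\in A\}$; $\mathfrak{L}(X,\vartriangleleft)$ is the complete lattice of $c_\vartriangleleft$-fixpoints (meet = intersection, join = $c_\vartriangleleft$ of union). $\neg_\vartriangleleft A=\{x\mid \forall y\vartriangleleft x,\ y\notin A\}$; $\Box_RA=\{x\mid \forall y(xRy\Rightarrow y\in A)\}$; $\Diamond_QA=\{x\mid \forall x'\vartriangleleft x\ \exists y'\,(x'Qy')\ \exists y\vartriangleright y': y\in A\}$. An embedding is an injective map preserving $\wedge,\vee,0,1,\neg,\Box,\Diamond$. *)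

theory Defs
  imports "HOL-Analysis.Abstract_Topology"
begin

section \<open>Bounded lattices with negation and modalities\<close>

definition multiplicative_op :: "('a::bounded_lattice \<Rightarrow> 'a) \<Rightarrow> bool" where
  "multiplicative_op f \<longleftrightarrow> (\<forall>a b. f (inf a b) = inf (f a) (f b)) \<and> f top = top"

definition additive_op :: "('a::bounded_lattice \<Rightarrow> 'a) \<Rightarrow> bool" where
  "additive_op f \<longleftrightarrow> (\<forall>a b. f (sup a b) = sup (f a) (f b)) \<and> f bot = bot"

text \<open>Filters and ideals are nonempty but not necessarily proper.\<close>

definition lattice_filter :: "'a::lattice set \<Rightarrow> bool" where
  "lattice_filter F \<longleftrightarrow> F \<noteq> {} \<and> (\<forall>a\<in>F. \<forall>b. a \<le> b \<longrightarrow> b \<in> F) \<and> (\<forall>a\<in>F. \<forall>b\<in>F. inf a b \<in> F)"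

definition lattice_ideal :: "'a::lattice set \<Rightarrow> bool" where
  "lattice_ideal I \<longleftrightarrow> I \<noteq> {} \<and> (\<forall>a\<in>I. \<forall>b. b \<le> a \<longrightarrow> b \<in> I) \<and> (\<forall>a\<in>I. \<forall>b\<in>I. sup a b \<in> I)"

text \<open>
  Algebras in the signature of meet, join, 0, 1, negation, box and diamond, on an explicit carrier.
  The record carries no laws; it only serves to compare the lattice with the algebra of a frame.
\<close>

record 'a modal_algebra =
  Carr :: "'a set"
  Meet :: "'a \<Rightarrow> 'a \<Rightarrow> 'a"
  Join :: "'a \<Rightarrow> 'a \<Rightarrow> 'a"
  Zero :: "'a"
  One :: "'a"
  Neg :: "'a \<Rightarrow> 'a"
  Box :: "'a \<Rightarrow> 'a"
  Dia :: "'a \<Rightarrow> 'a"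

definition lattice_algebra ::
  "('a::bounded_lattice \<Rightarrow> 'a) \<Rightarrow> ('a \<Rightarrow> 'a) \<Rightarrow> ('a \<Rightarrow> 'a) \<Rightarrow> 'a modal_algebra" where
  "lattice_algebra neg box dia =
    \<lparr>Carr = UNIV, Meet = inf, Join = sup, Zero = bot, One = top,
     Neg = neg, Box = box, Dia = dia\<rparr>"

definition algebra_embedding :: "'a modal_algebra \<Rightarrow> 'b modal_algebra \<Rightarrow> ('a \<Rightarrow> 'b) \<Rightarrow> bool" where
  "algebra_embedding A B h \<longleftrightarrow>
    h \<in> Carr A \<rightarrow> Carr B \<and> inj_on h (Carr A) \<and>
    (\<forall>a\<in>Carr A. \<forall>b\<in>Carr A. h (Meet A a b) = Meet B (h a) (h b)) \<and>
    (\<forall>a\<in>Carr A. \<forall>b\<in>Carr A. h (Join A a b) = Join B (h a) (h b)) \<and>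
    h (Zero A) = Zero B \<and>
    h (One A) = One B \<and>
    (\<forall>a\<in>Carr A. h (Neg A a) = Neg B (h a)) \<and>
    (\<forall>a\<in>Carr A. h (Box A a) = Box B (h a)) \<and>
    (\<forall>a\<in>Carr A. h (Dia A a) = Dia B (h a))"

definition algebra_isomorphism :: "'a modal_algebra \<Rightarrow> 'b modal_algebra \<Rightarrow> ('a \<Rightarrow> 'b) \<Rightarrow> bool" where
  "algebra_isomorphism A B h \<longleftrightarrow> algebra_embedding A B h \<and> h ` Carr A = Carr B"

definition is_subuniverse :: "'a set \<Rightarrow> 'a modal_algebra \<Rightarrow> bool" where
  "is_subuniverse S A \<longleftrightarrow>
    S \<subseteq> Carr A \<and> Zero A \<in> S \<and> One A \<in> S \<and>
    (\<forall>a\<in>S. \<forall>b\<in>S. Meet A a b \<in> S \<and> Join A a b \<in> S) \<and>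
    (\<forall>a\<in>S. Neg A a \<in> S \<and> Box A a \<in> S \<and> Dia A a \<in> S)"

section \<open>Modal frames and their algebras of fixpoints\<close>

text \<open>
  A frame has a carrier set \<open>X\<close> and relations \<open>T\<close> (the triangle, \<open>T y x\<close> being
  \<open>y \<lhd> x\<close>), \<open>R\<close> and \<open>Q\<close>. The relations are used on \<open>X\<close> only: every quantifier is bounded
  by \<open>X\<close>.
\<close>

type_synonym 'x relation = "'x \<Rightarrow> 'x \<Rightarrow> bool"

definition modal_frame :: "'x set \<Rightarrow> 'x relation \<Rightarrow> 'x relation \<Rightarrow> 'x relation \<Rightarrow> bool" where
  "modal_frame X T R Q \<longleftrightarrow> X \<noteq> {} \<and>
    (\<forall>x\<in>X. \<forall>y\<in>X. \<forall>z\<in>X. R x y \<and> T z y \<longrightarrow>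
      (\<exists>x'\<in>X. T x' x \<and> (\<forall>x''\<in>X. T x' x'' \<longrightarrow> (\<exists>y''\<in>X. R x'' y'' \<and> T z y''))))"

definition additive_modal_frame :: "'x set \<Rightarrow> 'x relation \<Rightarrow> 'x relation \<Rightarrow> 'x relation \<Rightarrow> bool" where
  "additive_modal_frame X T R Q \<longleftrightarrow> modal_frame X T R Q \<and>
    (\<forall>x\<in>X. \<forall>y\<in>X. \<forall>z\<in>X. Q x y \<and> T y z \<longrightarrow>
      (\<exists>x'\<in>X. T x x' \<and> (\<forall>x''\<in>X. T x'' x' \<longrightarrow> (\<exists>y''\<in>X. Q x'' y'' \<and> T y'' z))))"

definition frame_closure :: "'x set \<Rightarrow> 'x relation \<Rightarrow> 'x set \<Rightarrow> 'x set" where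
  "frame_closure X T A = {x\<in>X. \<forall>y\<in>X. T y x \<longrightarrow> (\<exists>z\<in>X. T y z \<and> z \<in> A)}"

definition frame_fixpoints :: "'x set \<Rightarrow> 'x relation \<Rightarrow> 'x set set" where
  "frame_fixpoints X T = {A. A \<subseteq> X \<and> frame_closure X T A = A}"

definition frame_neg :: "'x set \<Rightarrow> 'x relation \<Rightarrow> 'x set \<Rightarrow> 'x set" where
  "frame_neg X T A = {x\<in>X. \<forall>y\<in>X. T y x \<longrightarrow> y \<notin> A}"

definition frame_box :: "'x set \<Rightarrow> 'x relation \<Rightarrow> 'x set \<Rightarrow> 'x set" where
  "frame_box X R A = {x\<in>X. \<forall>y\<in>X. R x y \<longrightarrow> y \<in> A}"

definition frame_dia :: "'x set \<Rightarrow> 'x relation \<Rightarrow> 'x relation \<Rightarrow> 'x set \<Rightarrow> 'x set" where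
  "frame_dia X T Q A =
    {x\<in>X. \<forall>x'\<in>X. T x' x \<longrightarrow> (\<exists>y'\<in>X. Q x' y' \<and> (\<exists>y\<in>X. T y' y \<and> y \<in> A))}"

text \<open>
  The least fixpoint is the closure of the empty join, which need not be empty: it consists
  of the points \<open>x\<close> having no \<open>y \<lhd> x\<close>.
\<close>

definition frame_algebra ::
  "'x set \<Rightarrow> 'x relation \<Rightarrow> 'x relation \<Rightarrow> 'x relation \<Rightarrow> 'x set modal_algebra" where
  "frame_algebra X T R Q =
    \<lparr>Carr = frame_fixpoints X T,
     Meet = (\<inter>),
     Join = (\<lambda>A B. frame_closure X T (A \<union> B)),
     Zero = frame_closure X T {},
     One = X,
     Neg = frame_neg X T,
     Box = frame_box X R,
     Dia = frame_dia X T Q\<rparr>"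

text \<open>
  These operations are the lattice operations of the fixpoints ordered by inclusion, and the
  fixpoints are closed under all of them.
\<close>

lemma frame_closure_mono: "A \<subseteq> B \<Longrightarrow> frame_closure X T A \<subseteq> frame_closure X T B"
  unfolding frame_closure_def by blast

lemma frame_closure_increasing: "A \<subseteq> X \<Longrightarrow> A \<subseteq> frame_closure X T A"
  unfolding frame_closure_def by blast

lemma frame_closure_in_fixpoints: "frame_closure X T A \<in> frame_fixpoints X T"
  unfolding frame_fixpoints_def frame_closure_def by blast

lemma frame_fixpoints_Inter:
  assumes "\<A> \<subseteq> frame_fixpoints X T"
  shows "X \<inter> \<Inter>\<A> \<in> frame_fixpoints X T"
proof -
  have "frame_closure X T (X \<inter> \<Inter>\<A>) \<subseteq> A" if "A \<in> \<A>" for A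
  proof -
    have "frame_closure X T (X \<inter> \<Inter>\<A>) \<subseteq> frame_closure X T A"
      by (rule frame_closure_mono) (use that in blast)
    moreover have "frame_closure X T A = A"
      using assms that unfolding frame_fixpoints_def by auto
    ultimately show ?thesis by simp
  qed
  moreover have "frame_closure X T (X \<inter> \<Inter>\<A>) \<subseteq> X"
    unfolding frame_closure_def by (rule Collect_restrict)
  moreover have "X \<inter> \<Inter>\<A> \<subseteq> frame_closure X T (X \<inter> \<Inter>\<A>)"
    by (rule frame_closure_increasing) (rule Int_lower1)
  ultimately have "frame_closure X T (X \<inter> \<Inter>\<A>) = X \<inter> \<Inter>\<A>"
    by (intro equalityI) (auto intro: Int_greatest Inter_greatest)
  then show ?thesis unfolding frame_fixpoints_def by simp
qed

lemma frame_fixpoints_lub: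
  assumes "\<A> \<subseteq> frame_fixpoints X T"
  shows "\<And>A. A \<in> \<A> \<Longrightarrow> A \<subseteq> frame_closure X T (\<Union>\<A>)"
    and "\<And>B. B \<in> frame_fixpoints X T \<Longrightarrow> (\<And>A. A \<in> \<A> \<Longrightarrow> A \<subseteq> B) \<Longrightarrow> frame_closure X T (\<Union>\<A>) \<subseteq> B"
proof -
  fix A assume "A \<in> \<A>"
  moreover have "\<Union>\<A> \<subseteq> X" using assms unfolding frame_fixpoints_def by blast
  ultimately show "A \<subseteq> frame_closure X T (\<Union>\<A>)"
    using frame_closure_increasing by blast
next
  fix B assume "B \<in> frame_fixpoints X T" "\<And>A. A \<in> \<A> \<Longrightarrow> A \<subseteq> B"
  then show "frame_closure X T (\<Union>\<A>) \<subseteq> B"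
    using frame_closure_mono[of "\<Union>\<A>" B X T] unfolding frame_fixpoints_def by blast
qed

lemma frame_neg_in_fixpoints: "frame_neg X T A \<in> frame_fixpoints X T"
  unfolding frame_fixpoints_def frame_neg_def frame_closure_def by blast

lemma frame_dia_in_fixpoints: "frame_dia X T Q A \<in> frame_fixpoints X T"
  unfolding frame_fixpoints_def frame_dia_def frame_closure_def by blast

lemma frame_box_in_fixpoints:
  assumes "modal_frame X T R Q" "A \<in> frame_fixpoints X T"
  shows "frame_box X R A \<in> frame_fixpoints X T"
proof -
  have "y \<in> A" if x: "x \<in> frame_closure X T (frame_box X R A)" and y: "y \<in> X" "R x y" for x y
  proof -
    have "\<exists>w\<in>X. T z w \<and> w \<in> A" if z: "z \<in> X" "T z y" for z
    proof -
      from x have "x \<in> X" unfolding frame_closure_def by simp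
      with assms(1) y z have "\<exists>x'\<in>X. T x' x \<and>
          (\<forall>x''\<in>X. T x' x'' \<longrightarrow> (\<exists>y''\<in>X. R x'' y'' \<and> T z y''))"
        unfolding modal_frame_def by simp
      then obtain x' where x': "x' \<in> X" "T x' x"
        and ex: "\<forall>x''\<in>X. T x' x'' \<longrightarrow> (\<exists>y''\<in>X. R x'' y'' \<and> T z y'')"
        by (elim bexE conjE)
      from x x' obtain x'' where x'': "x'' \<in> X" "T x' x''" "x'' \<in> frame_box X R A"
        unfolding frame_closure_def by auto
      with ex obtain y'' where "y'' \<in> X" "R x'' y''" "T z y''" by auto
      with x'' show ?thesis unfolding frame_box_def by auto
    qed
    with y(1) have "y \<in> frame_closure X T A" unfolding frame_closure_def by blast
    with assms(2) show ?thesis unfolding frame_fixpoints_def by blast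
  qed
  then have "frame_closure X T (frame_box X R A) \<subseteq> frame_box X R A"
    unfolding frame_closure_def frame_box_def by blast
  moreover have "frame_box X R A \<subseteq> X" unfolding frame_box_def by blast
  ultimately show ?thesis
    using frame_closure_increasing[of "frame_box X R A" X T]
    unfolding frame_fixpoints_def by blast
qed

lemma frame_algebra_closed:
  assumes "modal_frame X T R Q"
  shows "is_subuniverse (frame_fixpoints X T) (frame_algebra X T R Q)"
proof -
  have "X \<in> frame_fixpoints X T" using frame_fixpoints_Inter[of "{}" X T] by simp
  moreover have "A \<inter> B \<in> frame_fixpoints X T"
    if "A \<in> frame_fixpoints X T" "B \<in> frame_fixpoints X T" for A B
  proof -
    have "X \<inter> \<Inter>{A, B} = A \<inter> B" using that unfolding frame_fixpoints_def by auto
    with frame_fixpoints_Inter[of "{A, B}" X T] that show ?thesis by simp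
  qed
  ultimately show ?thesis
    unfolding is_subuniverse_def frame_algebra_def
    by (simp add: frame_closure_in_fixpoints frame_neg_in_fixpoints frame_dia_in_fixpoints
        frame_box_in_fixpoints[OF assms])
qed

section \<open>The frame of filter-ideal pairs\<close>

definition fi_pairs :: "('a::bounded_lattice \<Rightarrow> 'a) \<Rightarrow> ('a set \<times> 'a set) set" where
  "fi_pairs neg = {(F, I). lattice_filter F \<and> lattice_ideal I \<and> neg ` F \<subseteq> I}"

definition fi_tri :: "('a set \<times> 'a set) relation" where
  "fi_tri = (\<lambda>(F, I) (F', I'). I \<inter> F' = {})"

definition fi_R :: "('a \<Rightarrow> 'a) \<Rightarrow> ('a set \<times> 'a set) relation" where
  "fi_R box = (\<lambda>(F, I) (F', I'). \<forall>a. box a \<in> F \<longrightarrow> a \<in> F')"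

definition fi_Q :: "('a \<Rightarrow> 'a) \<Rightarrow> ('a set \<times> 'a set) relation" where
  "fi_Q dia = (\<lambda>(F, I) (F', I'). \<forall>a. dia a \<in> I \<longrightarrow> a \<in> I')"

definition fi_algebra ::
  "('a::bounded_lattice \<Rightarrow> 'a) \<Rightarrow> ('a \<Rightarrow> 'a) \<Rightarrow> ('a \<Rightarrow> 'a) \<Rightarrow> ('a set \<times> 'a set) set modal_algebra" where
  "fi_algebra neg box dia = frame_algebra (fi_pairs neg) fi_tri (fi_R box) (fi_Q dia)"

definition fi_hat :: "('a::bounded_lattice \<Rightarrow> 'a) \<Rightarrow> 'a \<Rightarrow> ('a set \<times> 'a set) set" where
  "fi_hat neg a = {(F, I) \<in> fi_pairs neg. a \<in> F}"

text \<open>The underlying space is \<open>fi_pairs neg\<close>, since every filter contains the top element.\<close>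

definition fi_topology :: "('a::bounded_lattice \<Rightarrow> 'a) \<Rightarrow> ('a set \<times> 'a set) topology" where
  "fi_topology neg = topology_generated_by (range (fi_hat neg))"

definition compact_open_fixpoints ::
  "('a::bounded_lattice \<Rightarrow> 'a) \<Rightarrow> ('a set \<times> 'a set) set set" where
  "compact_open_fixpoints neg =
    {A \<in> frame_fixpoints (fi_pairs neg) fi_tri.
      compactin (fi_topology neg) A \<and> openin (fi_topology neg) A}"

lemma topspace_fi_topology: "topspace (fi_topology neg) = fi_pairs neg"
proof -
  have "fi_hat neg top = fi_pairs neg"
    unfolding fi_hat_def fi_pairs_def lattice_filter_def by force
  moreover have "fi_hat neg a \<subseteq> fi_pairs neg" for a unfolding fi_hat_def by blast
  ultimately have "(\<Union>a. fi_hat neg a) = fi_pairs neg" by blast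
  then show ?thesis unfolding fi_topology_def by simp
qed

end

theory Submission
  imports Defs
begin

text \<open>
  Every separation step uses a pair with an extreme coordinate. If \<open>a \<notin> F\<close>, then
  \<open>({top}, {..a})\<close> lies below \<open>(F, I)\<close> but below no point of the hat of \<open>a\<close>; if \<open>a \<notin> I\<close>, then
  \<open>({a..}, UNIV)\<close> lies above \<open>(F, I)\<close> and in the hat of \<open>a\<close>. Hence hats are fixpoints and the
  hat map respects all operations. Opens are unions of hats, and every open set containing the generic
  point \<open>({a..}, UNIV)\<close> contains the hat of \<open>a\<close>, so hats are compact. A compact open set
  is a finite union of hats, whose closure is the hat of the join.
\<close>

section \<open>Filters, ideals and their pairs\<close>

lemma lattice_filter_topD: "lattice_filter F \<Longrightarrow> (top::'a::bounded_lattice) \<in> F"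
  unfolding lattice_filter_def by (meson ex_in_conv top_greatest)

lemma lattice_ideal_botD: "lattice_ideal I \<Longrightarrow> (bot::'a::bounded_lattice) \<in> I"
  unfolding lattice_ideal_def by (meson ex_in_conv bot_least)

lemma lattice_filter_upward: "lattice_filter F \<Longrightarrow> a \<in> F \<Longrightarrow> a \<le> b \<Longrightarrow> b \<in> F"
  unfolding lattice_filter_def by blast

lemma lattice_ideal_downward: "lattice_ideal I \<Longrightarrow> b \<in> I \<Longrightarrow> a \<le> b \<Longrightarrow> a \<in> I"
  unfolding lattice_ideal_def by blast

lemma lattice_filter_inf_iff: "lattice_filter F \<Longrightarrow> inf a b \<in> F \<longleftrightarrow> a \<in> F \<and> b \<in> F"
  unfolding lattice_filter_def by (meson inf_le1 inf_le2)

lemma lattice_ideal_sup_iff: "lattice_ideal I \<Longrightarrow> sup a b \<in> I \<longleftrightarrow> a \<in> I \<and> b \<in> I"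
  unfolding lattice_ideal_def by (meson sup_ge1 sup_ge2)

lemma lattice_filter_atLeast: "lattice_filter {a..}"
  unfolding lattice_filter_def by (auto intro: order_trans)

lemma lattice_ideal_atMost: "lattice_ideal {..a}"
  unfolding lattice_ideal_def by (auto intro: order_trans)

lemma lattice_filter_top: "lattice_filter {top::'a::bounded_lattice}"
  unfolding lattice_filter_def by (simp add: top_unique)

lemma lattice_filter_UNIV: "lattice_filter UNIV"
  unfolding lattice_filter_def by simp

lemma lattice_ideal_UNIV: "lattice_ideal UNIV"
  unfolding lattice_ideal_def by simp

section \<open>Filters and ideals transported along the modal operators\<close>

lemma multiplicative_op_mono: "multiplicative_op f \<Longrightarrow> a \<le> b \<Longrightarrow> f a \<le> f b"
  unfolding multiplicative_op_def by (metis inf.absorb_iff1)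

lemma additive_op_mono: "additive_op f \<Longrightarrow> a \<le> b \<Longrightarrow> f a \<le> f b"
  unfolding additive_op_def by (metis sup.absorb_iff2)

text \<open>For \<open>f = box\<close>, this preimage is the least filter that \<open>fi_R\<close>
  allows in a successor of a point with filter \<open>F\<close>.\<close>

lemma lattice_filter_vimage:
  assumes "multiplicative_op f" "lattice_filter F"
  shows "lattice_filter (f -` F)"
  unfolding lattice_filter_def
proof (intro conjI ballI allI impI)
  show "f -` F \<noteq> {}"
    using assms lattice_filter_topD unfolding multiplicative_op_def by (metis empty_iff vimageI2)
next
  fix a b assume "a \<in> f -` F" "a \<le> b"
  then show "b \<in> f -` F"
    using multiplicative_op_mono[OF assms(1), of a b] lattice_filter_upward[OF assms(2)] by simp
next
  fix a b assume "a \<in> f -` F" "b \<in> f -` F"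
  then show "inf a b \<in> f -` F"
    using assms by (simp add: multiplicative_op_def lattice_filter_inf_iff)
qed

text \<open>For \<open>f = dia\<close>, this preimage is the least ideal that \<open>fi_Q\<close>
  allows in a successor; a least ideal puts the successor below as many points as possible.\<close>

lemma lattice_ideal_vimage:
  assumes "additive_op f" "lattice_ideal I"
  shows "lattice_ideal (f -` I)"
  unfolding lattice_ideal_def
proof (intro conjI ballI allI impI)
  show "f -` I \<noteq> {}"
    using assms lattice_ideal_botD unfolding additive_op_def by (metis empty_iff vimageI2)
next
  fix a b assume "a \<in> f -` I" "b \<le> a"
  then show "b \<in> f -` I"
    using additive_op_mono[OF assms(1), of b a] lattice_ideal_downward[OF assms(2)] by simp
next
  fix a b assume "a \<in> f -` I" "b \<in> f -` I"
  then show "sup a b \<in> f -` I"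
    using assms by (simp add: additive_op_def lattice_ideal_sup_iff)
qed

text \<open>Elements below \<open>f c\<close> and \<open>f d\<close> have their join below
  \<open>f (sup c d)\<close>, so monotonicity suffices. This matters for \<open>box\<close>, which
  need not preserve joins.\<close>

lemma lattice_ideal_mono_image:
  assumes mono: "\<And>a b. a \<le> b \<Longrightarrow> f a \<le> f b" and I: "lattice_ideal I"
  shows "lattice_ideal {b. \<exists>a\<in>I. b \<le> f a}"
  unfolding lattice_ideal_def
proof (intro conjI ballI allI impI)
  obtain a where "a \<in> I" using I unfolding lattice_ideal_def by (meson ex_in_conv)
  then have "f a \<in> {b. \<exists>a\<in>I. b \<le> f a}" by blast
  then show "{b. \<exists>a\<in>I. b \<le> f a} \<noteq> {}" by (metis empty_iff)
next
  fix a b assume "a \<in> {b. \<exists>a\<in>I. b \<le> f a}" "b \<le> a"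
  then show "b \<in> {b. \<exists>a\<in>I. b \<le> f a}" by (blast intro: order_trans)
next
  fix a b assume "a \<in> {b. \<exists>a\<in>I. b \<le> f a}" "b \<in> {b. \<exists>a\<in>I. b \<le> f a}"
  then obtain c d where "c \<in> I" "d \<in> I" "a \<le> f c" "b \<le> f d" by blast
  then have "sup c d \<in> I" "sup a b \<le> f (sup c d)"
    using I mono by (auto simp: lattice_ideal_sup_iff intro: order_trans)
  then show "sup a b \<in> {b. \<exists>a\<in>I. b \<le> f a}" by blast
qed

text \<open>Order dual of the previous argument, meant for \<open>dia\<close>, which need not
  preserve meets.\<close>

lemma lattice_filter_mono_image:
  assumes mono: "\<And>a b. a \<le> b \<Longrightarrow> f a \<le> f b" and F: "lattice_filter F"
  shows "lattice_filter {b. \<exists>a\<in>F. f a \<le> b}"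
  unfolding lattice_filter_def
proof (intro conjI ballI allI impI)
  obtain a where "a \<in> F" using F unfolding lattice_filter_def by (meson ex_in_conv)
  then have "f a \<in> {b. \<exists>a\<in>F. f a \<le> b}" by blast
  then show "{b. \<exists>a\<in>F. f a \<le> b} \<noteq> {}" by (metis empty_iff)
next
  fix a b assume "a \<in> {b. \<exists>a\<in>F. f a \<le> b}" "a \<le> b"
  then show "b \<in> {b. \<exists>a\<in>F. f a \<le> b}" by (blast intro: order_trans)
next
  fix a b assume "a \<in> {b. \<exists>a\<in>F. f a \<le> b}" "b \<in> {b. \<exists>a\<in>F. f a \<le> b}"
  then obtain c d where "c \<in> F" "d \<in> F" "f c \<le> a" "f d \<le> b" by blast
  then have "inf c d \<in> F" "f (inf c d) \<le> inf a b"
    using F mono[OF inf_le1, of c d] mono[OF inf_le2, of c d]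
    by (auto simp: lattice_filter_inf_iff intro: order_trans)
  then show "inf a b \<in> {b. \<exists>a\<in>F. f a \<le> b}" by blast
qed

section \<open>Points, their relations and the extreme pairs\<close>

lemma fi_pairs_iff:
  "(F, I) \<in> fi_pairs neg \<longleftrightarrow> lattice_filter F \<and> lattice_ideal I \<and> neg ` F \<subseteq> I"
  unfolding fi_pairs_def by simp

lemma fi_tri_iff: "fi_tri (F, I) (G, J) \<longleftrightarrow> I \<inter> G = {}"
  unfolding fi_tri_def by simp

lemma fi_R_iff: "fi_R box (F, I) (G, J) \<longleftrightarrow> box -` F \<subseteq> G"
  unfolding fi_R_def by auto

lemma fi_Q_iff: "fi_Q dia (F, I) (G, J) \<longleftrightarrow> dia -` I \<subseteq> J"
  unfolding fi_Q_def by auto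

lemma fi_hat_iff: "(F, I) \<in> fi_hat neg a \<longleftrightarrow> (F, I) \<in> fi_pairs neg \<and> a \<in> F"
  unfolding fi_hat_def by simp

lemma fi_hat_subset: "fi_hat neg a \<subseteq> fi_pairs neg"
  unfolding fi_hat_def by blast

text \<open>The only negation to absorb is \<open>neg top = bot\<close>, which lies in every ideal;
  so any ideal occurs as a second coordinate.\<close>

lemma top_ideal_in_fi_pairs:
  "neg top = bot \<Longrightarrow> lattice_ideal I \<Longrightarrow> ({top}, I) \<in> fi_pairs neg"
  by (simp add: fi_pairs_iff lattice_filter_top lattice_ideal_botD)

text \<open>The improper ideal absorbs all negations, so any filter occurs as a first
  coordinate.\<close>

lemma filter_UNIV_in_fi_pairs: "lattice_filter F \<Longrightarrow> (F, UNIV) \<in> fi_pairs neg"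
  by (simp add: fi_pairs_iff lattice_ideal_UNIV)

lemma generic_point_in_fi_hat: "({a..}, UNIV) \<in> fi_hat neg b \<longleftrightarrow> a \<le> b"
  by (simp add: fi_hat_iff filter_UNIV_in_fi_pairs lattice_filter_atLeast)

text \<open>A common element of \<open>I\<close> and \<open>{a..}\<close> would force
  \<open>a\<close> into \<open>I\<close>. On its left \<open>fi_tri\<close> reads only the ideal, so
  \<open>F\<close> is arbitrary.\<close>

lemma fi_hat_above:
  assumes "lattice_ideal I" "a \<notin> I"
  shows "\<exists>z\<in>fi_pairs neg. fi_tri (F, I) z \<and> z \<in> fi_hat neg a"
proof (intro bexI conjI)
  show "fi_tri (F, I) ({a..}, UNIV)"
    using assms lattice_ideal_downward by (force simp: fi_tri_iff)
qed (simp_all add: generic_point_in_fi_hat filter_UNIV_in_fi_pairs lattice_filter_atLeast)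

section \<open>The frame conditions\<close>

lemma modal_frame_fi_pairs:
  assumes neg: "neg top = bot" and box: "multiplicative_op box"
  shows "modal_frame (fi_pairs neg) fi_tri (fi_R box) Q"
proof -
  let ?X = "fi_pairs neg"
  have "(UNIV, UNIV) \<in> ?X" by (simp add: filter_UNIV_in_fi_pairs lattice_filter_UNIV)
  then have nonempty: "?X \<noteq> {}" by blast
  have "\<exists>x'\<in>?X. fi_tri x' (F, I) \<and>
      (\<forall>x''\<in>?X. fi_tri x' x'' \<longrightarrow> (\<exists>y''\<in>?X. fi_R box x'' y'' \<and> fi_tri (H, K) y''))"
    if x: "(F, I) \<in> ?X" and z: "(H, K) \<in> ?X"
      and R: "fi_R box (F, I) (G, J)" and T: "fi_tri (H, K) (G, J)" for F I G J H K
  proof -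
    \<comment> \<open>The ideal generated by the boxes of \<open>K\<close>: a point above
      \<open>({top}, ?I)\<close> has no \<open>box k\<close> with \<open>k \<in> K\<close> in its
      filter, so the preimage of that filter under \<open>box\<close> avoids
      \<open>K\<close>.\<close>
    let ?I = "{b. \<exists>k\<in>K. b \<le> box k}"
    have "lattice_ideal ?I"
      using z by (auto simp: fi_pairs_iff intro!: lattice_ideal_mono_image multiplicative_op_mono[OF box])
    then have "({top}, ?I) \<in> ?X" by (rule top_ideal_in_fi_pairs[of neg, OF neg])
    \<comment> \<open>If \<open>b \<in> F\<close> and \<open>b \<le> box k\<close>, then
      \<open>box k \<in> F\<close>, so \<open>k \<in> G\<close> by \<open>R\<close>, against
      \<open>T\<close>.\<close>
    moreover have "fi_tri ({top}, ?I) (F, I)"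
      using x R T lattice_filter_upward[of F] by (fastforce simp: fi_pairs_iff fi_R_iff fi_tri_iff)
    moreover have "\<exists>y''\<in>?X. fi_R box (F'', I'') y'' \<and> fi_tri (H, K) y''"
      if "(F'', I'') \<in> ?X" "fi_tri ({top}, ?I) (F'', I'')" for F'' I''
    proof (intro bexI conjI)
      show "(box -` F'', UNIV) \<in> ?X"
        using that lattice_filter_vimage[OF box] by (auto simp: fi_pairs_iff lattice_ideal_UNIV)
      show "fi_R box (F'', I'') (box -` F'', UNIV)" by (simp add: fi_R_iff)
      show "fi_tri (H, K) (box -` F'', UNIV)" using that by (auto simp: fi_tri_iff)
    qed
    ultimately show ?thesis by (intro bexI conjI) auto
  qed
  with nonempty show ?thesis unfolding modal_frame_def by auto
qed

lemma additive_modal_frame_fi_pairs: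
  assumes neg: "neg top = bot" and box: "multiplicative_op box" and dia: "additive_op dia"
  shows "additive_modal_frame (fi_pairs neg) fi_tri (fi_R box) (fi_Q dia)"
proof -
  let ?X = "fi_pairs neg"
  have "\<exists>x'\<in>?X. fi_tri (F, I) x' \<and>
      (\<forall>x''\<in>?X. fi_tri x'' x' \<longrightarrow> (\<exists>y''\<in>?X. fi_Q dia x'' y'' \<and> fi_tri y'' (H, K)))"
    if x: "(F, I) \<in> ?X" and z: "(H, K) \<in> ?X"
      and Q: "fi_Q dia (F, I) (G, J)" and T: "fi_tri (G, J) (H, K)" for F I G J H K
  proof -
    \<comment> \<open>Dually, a point below \<open>(?F, UNIV)\<close> has no \<open>dia h\<close>
      with \<open>h \<in> H\<close> in its ideal, so the preimage of that ideal under
      \<open>dia\<close> avoids \<open>H\<close>.\<close>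
    let ?F = "{b. \<exists>h\<in>H. dia h \<le> b}"
    have "lattice_filter ?F"
      using z by (auto simp: fi_pairs_iff intro!: lattice_filter_mono_image additive_op_mono[OF dia])
    then have "(?F, UNIV) \<in> ?X" by (rule filter_UNIV_in_fi_pairs)
    \<comment> \<open>If \<open>b \<in> I\<close> and \<open>dia h \<le> b\<close>, then
      \<open>dia h \<in> I\<close>, so \<open>h \<in> J\<close> by \<open>Q\<close>, against
      \<open>T\<close>.\<close>
    moreover have "fi_tri (F, I) (?F, UNIV)"
      using x Q T lattice_ideal_downward[of I] by (fastforce simp: fi_pairs_iff fi_Q_iff fi_tri_iff)
    moreover have "\<exists>y''\<in>?X. fi_Q dia (F'', I'') y'' \<and> fi_tri y'' (H, K)"
      if "(F'', I'') \<in> ?X" "fi_tri (F'', I'') (?F, UNIV)" for F'' I''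
    proof (intro bexI conjI)
      show "({top}, dia -` I'') \<in> ?X"
        using that lattice_ideal_vimage[OF dia]
        by (intro top_ideal_in_fi_pairs[of neg, OF neg]) (simp add: fi_pairs_iff)
      show "fi_Q dia (F'', I'') ({top}, dia -` I'')" by (simp add: fi_Q_iff)
      show "fi_tri ({top}, dia -` I'') (H, K)" using that by (auto simp: fi_tri_iff)
    qed
    ultimately show ?thesis by (intro bexI conjI) auto
  qed
  with modal_frame_fi_pairs[of neg, OF neg box] show ?thesis unfolding additive_modal_frame_def by auto
qed

section \<open>The embedding\<close>

lemma fi_hat_below:
  assumes "neg top = bot" "(F, I) \<in> fi_pairs neg" "a \<notin> F"
  shows "({top}, {..a}) \<in> fi_pairs neg" "fi_tri ({top}, {..a}) (F, I)"
proof -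
  show "({top}, {..a}) \<in> fi_pairs neg"
    using assms(1) lattice_ideal_atMost by (rule top_ideal_in_fi_pairs)
  show "fi_tri ({top}, {..a}) (F, I)"
    using assms(2,3) lattice_filter_upward[of F] by (auto simp: fi_tri_iff fi_pairs_iff)
qed

lemma frame_closure_fi_hat:
  assumes neg: "neg top = bot"
  shows "frame_closure (fi_pairs neg) fi_tri (fi_hat neg a) = fi_hat neg a"
proof (rule equalityI)
  show "frame_closure (fi_pairs neg) fi_tri (fi_hat neg a) \<subseteq> fi_hat neg a"
  proof (clarify)
    fix F I assume x: "(F, I) \<in> frame_closure (fi_pairs neg) fi_tri (fi_hat neg a)"
    then have X: "(F, I) \<in> fi_pairs neg" unfolding frame_closure_def by simp
    have "a \<in> F"
    proof (rule ccontr)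
      assume "a \<notin> F"
      from fi_hat_below[of neg, OF neg X this] x
      have "\<exists>z\<in>fi_pairs neg. fi_tri ({top}, {..a}) z \<and> z \<in> fi_hat neg a"
        unfolding frame_closure_def by blast
      \<comment> \<open>The filter of such a \<open>z\<close> contains \<open>a\<close> and would
        have to avoid \<open>{..a}\<close>.\<close>
      then show False by (auto simp: fi_tri_iff fi_hat_iff)
    qed
    with X show "(F, I) \<in> fi_hat neg a" by (simp add: fi_hat_iff)
  qed
qed (rule frame_closure_increasing[OF fi_hat_subset])

lemma fi_hat_in_fixpoints:
  "neg top = bot \<Longrightarrow> fi_hat neg a \<in> frame_fixpoints (fi_pairs neg) fi_tri"
  using fi_hat_subset by (simp add: frame_fixpoints_def frame_closure_fi_hat)

text \<open>The generic point of \<open>a\<close> lies in the hat of \<open>b\<close> only if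
  \<open>a \<le> b\<close>, so it alone tests the inclusion.\<close>

lemma fi_hat_subset_iff: "fi_hat neg a \<subseteq> fi_hat neg b \<longleftrightarrow> a \<le> b"
proof
  assume "fi_hat neg a \<subseteq> fi_hat neg b"
  then show "a \<le> b" using generic_point_in_fi_hat[of a neg] by blast
next
  assume "a \<le> b"
  then show "fi_hat neg a \<subseteq> fi_hat neg b"
    by (auto simp: fi_hat_iff fi_pairs_iff intro: lattice_filter_upward)
qed

lemma inj_fi_hat: "inj (fi_hat neg)"
  by (rule injI) (metis fi_hat_subset_iff order_antisym order_refl)

section \<open>Preservation of the operations by the hat map\<close>

lemma fi_hat_inf: "fi_hat neg (inf a b) = fi_hat neg a \<inter> fi_hat neg b"
  by (auto simp: fi_hat_iff fi_pairs_iff lattice_filter_inf_iff)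

lemma fi_hat_top: "fi_hat neg top = fi_pairs neg"
  by (auto simp: fi_hat_iff fi_pairs_iff lattice_filter_topD)

text \<open>An ideal that omits \<open>sup a b\<close> omits \<open>a\<close> or \<open>b\<close>,
  which gives a point of one of the two hats above it. The other inclusion holds because hats are
  fixpoints.\<close>

lemma fi_hat_sup:
  assumes neg: "neg top = bot"
  shows "fi_hat neg (sup a b) = frame_closure (fi_pairs neg) fi_tri (fi_hat neg a \<union> fi_hat neg b)"
proof (rule equalityI)
  show "fi_hat neg (sup a b) \<subseteq> frame_closure (fi_pairs neg) fi_tri (fi_hat neg a \<union> fi_hat neg b)"
  proof (clarify)
    fix F I assume x: "(F, I) \<in> fi_hat neg (sup a b)"
    have "\<exists>z\<in>fi_pairs neg. fi_tri (G, J) z \<and> z \<in> fi_hat neg a \<union> fi_hat neg b"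
      if "(G, J) \<in> fi_pairs neg" "fi_tri (G, J) (F, I)" for G J
    proof -
      have "lattice_ideal J" using that by (simp add: fi_pairs_iff)
      moreover from this that x have "a \<notin> J \<or> b \<notin> J"
        by (auto simp: fi_tri_iff fi_hat_iff dest: lattice_ideal_sup_iff)
      ultimately show ?thesis using fi_hat_above by blast
    qed
    with x show "(F, I) \<in> frame_closure (fi_pairs neg) fi_tri (fi_hat neg a \<union> fi_hat neg b)"
      unfolding frame_closure_def by (auto simp: fi_hat_iff)
  qed
next
  have "fi_hat neg a \<union> fi_hat neg b \<subseteq> fi_hat neg (sup a b)"
    by (simp add: fi_hat_subset_iff)
  from frame_closure_mono[OF this, of "fi_pairs neg" fi_tri]
  show "frame_closure (fi_pairs neg) fi_tri (fi_hat neg a \<union> fi_hat neg b) \<subseteq> fi_hat neg (sup a b)"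
    by (simp add: frame_closure_fi_hat[of neg, OF neg])
qed

text \<open>Every ideal contains \<open>bot\<close>, so nothing lies below a point whose filter
  contains \<open>bot\<close>.\<close>

lemma fi_hat_bot:
  assumes neg: "neg top = bot"
  shows "fi_hat neg bot = frame_closure (fi_pairs neg) fi_tri {}"
proof (rule equalityI)
  show "fi_hat neg bot \<subseteq> frame_closure (fi_pairs neg) fi_tri {}"
    unfolding frame_closure_def
    by (auto simp: fi_hat_iff fi_tri_iff fi_pairs_iff dest!: lattice_ideal_botD)
  show "frame_closure (fi_pairs neg) fi_tri {} \<subseteq> fi_hat neg bot"
    using frame_closure_mono[of "{}" "fi_hat neg bot"] frame_closure_fi_hat[of neg, OF neg] by blast
qed

text \<open>If \<open>a\<close> is in the filter of a point, then \<open>neg a\<close> is in its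
  ideal, so that point is not below one with \<open>neg a\<close> in its filter.\<close>

lemma fi_hat_neg:
  assumes anti: "antimono neg"
  shows "fi_hat neg (neg a) = frame_neg (fi_pairs neg) fi_tri (fi_hat neg a)"
proof (rule equalityI)
  show "fi_hat neg (neg a) \<subseteq> frame_neg (fi_pairs neg) fi_tri (fi_hat neg a)"
    unfolding frame_neg_def
    by (clarsimp simp: fi_hat_iff fi_tri_iff fi_pairs_iff) blast
  show "frame_neg (fi_pairs neg) fi_tri (fi_hat neg a) \<subseteq> fi_hat neg (neg a)"
  proof (clarify)
    fix F I assume x: "(F, I) \<in> frame_neg (fi_pairs neg) fi_tri (fi_hat neg a)"
    then have X: "(F, I) \<in> fi_pairs neg" unfolding frame_neg_def by simp
    \<comment> \<open>The generic point of \<open>a\<close> with its ideal shrunk as far as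
      antitonicity permits. It is in the hat of \<open>a\<close>, so it cannot be below
      \<open>(F, I)\<close>, and \<open>F\<close> must meet \<open>{..neg a}\<close>.\<close>
    have y: "({a..}, {..neg a}) \<in> fi_pairs neg"
      using anti by (auto simp: fi_pairs_iff lattice_filter_atLeast lattice_ideal_atMost antimonoD)
    with x have "\<not> fi_tri ({a..}, {..neg a}) (F, I)"
      unfolding frame_neg_def by (auto simp: fi_hat_iff)
    with X have "neg a \<in> F"
      by (auto simp: fi_tri_iff fi_pairs_iff intro: lattice_filter_upward)
    with X show "(F, I) \<in> fi_hat neg (neg a)" by (simp add: fi_hat_iff)
  qed
qed

text \<open>One successor decides: the filter that is the preimage of \<open>F\<close> under
  \<open>box\<close> contains \<open>a\<close> exactly when \<open>box a \<in> F\<close>.\<close>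

lemma fi_hat_box:
  assumes box: "multiplicative_op box"
  shows "fi_hat neg (box a) = frame_box (fi_pairs neg) (fi_R box) (fi_hat neg a)"
proof (rule equalityI)
  show "fi_hat neg (box a) \<subseteq> frame_box (fi_pairs neg) (fi_R box) (fi_hat neg a)"
    unfolding frame_box_def by (auto simp: fi_hat_iff fi_R_def)
  show "frame_box (fi_pairs neg) (fi_R box) (fi_hat neg a) \<subseteq> fi_hat neg (box a)"
  proof (clarify)
    fix F I assume x: "(F, I) \<in> frame_box (fi_pairs neg) (fi_R box) (fi_hat neg a)"
    then have X: "(F, I) \<in> fi_pairs neg" unfolding frame_box_def by simp
    then have "(box -` F, UNIV) \<in> fi_pairs neg"
      using lattice_filter_vimage[OF box] by (simp add: fi_pairs_iff lattice_ideal_UNIV)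
    with x have "(box -` F, UNIV) \<in> fi_hat neg a"
      unfolding frame_box_def by (auto simp: fi_R_iff)
    with X show "(F, I) \<in> fi_hat neg (box a)" by (simp add: fi_hat_iff)
  qed
qed

text \<open>If \<open>dia a\<close> is outside \<open>J\<close>, the preimage of \<open>J\<close>
  under \<open>dia\<close> omits \<open>a\<close> and \<open>fi_hat_above\<close> applies.
  Conversely, every \<open>fi_Q\<close> successor of \<open>({top}, {..dia a})\<close> has
  \<open>a\<close> in its ideal, so it is below no point of the hat of \<open>a\<close>.\<close>

lemma fi_hat_dia:
  assumes neg: "neg top = bot" and dia: "additive_op dia"
  shows "fi_hat neg (dia a) = frame_dia (fi_pairs neg) fi_tri (fi_Q dia) (fi_hat neg a)"
proof (rule equalityI)
  show "fi_hat neg (dia a) \<subseteq> frame_dia (fi_pairs neg) fi_tri (fi_Q dia) (fi_hat neg a)"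
  proof (clarify)
    fix F I assume x: "(F, I) \<in> fi_hat neg (dia a)"
    have "\<exists>y'\<in>fi_pairs neg. fi_Q dia (G, J) y' \<and> (\<exists>y\<in>fi_pairs neg. fi_tri y' y \<and> y \<in> fi_hat neg a)"
      if "(G, J) \<in> fi_pairs neg" "fi_tri (G, J) (F, I)" for G J
    proof (rule bexI[of _ "({top}, dia -` J)"], rule conjI)
      have J: "lattice_ideal (dia -` J)"
        using that lattice_ideal_vimage[OF dia] by (simp add: fi_pairs_iff)
      then show "({top}, dia -` J) \<in> fi_pairs neg" by (rule top_ideal_in_fi_pairs[of neg, OF neg])
      show "fi_Q dia (G, J) ({top}, dia -` J)" by (simp add: fi_Q_iff)
      have "a \<notin> dia -` J" using that x by (auto simp: fi_tri_iff fi_hat_iff)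
      with J show "\<exists>y\<in>fi_pairs neg. fi_tri ({top}, dia -` J) y \<and> y \<in> fi_hat neg a"
        by (rule fi_hat_above)
    qed
    with x show "(F, I) \<in> frame_dia (fi_pairs neg) fi_tri (fi_Q dia) (fi_hat neg a)"
      unfolding frame_dia_def by (auto simp: fi_hat_iff)
  qed
  show "frame_dia (fi_pairs neg) fi_tri (fi_Q dia) (fi_hat neg a) \<subseteq> fi_hat neg (dia a)"
  proof (clarify)
    fix F I assume x: "(F, I) \<in> frame_dia (fi_pairs neg) fi_tri (fi_Q dia) (fi_hat neg a)"
    then have X: "(F, I) \<in> fi_pairs neg" unfolding frame_dia_def by simp
    have "dia a \<in> F"
    proof (rule ccontr)
      assume "dia a \<notin> F"
      from fi_hat_below[of neg, OF neg X this] x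
      have "\<exists>y'\<in>fi_pairs neg. fi_Q dia ({top}, {..dia a}) y' \<and>
          (\<exists>y\<in>fi_pairs neg. fi_tri y' y \<and> y \<in> fi_hat neg a)"
        unfolding frame_dia_def by blast
      then show False by (fastforce simp: fi_Q_iff fi_tri_iff fi_hat_iff)
    qed
    with X show "(F, I) \<in> fi_hat neg (dia a)" by (simp add: fi_hat_iff)
  qed
qed

lemma fi_hat_embedding:
  assumes "antimono neg" "neg top = bot" "multiplicative_op box" "additive_op dia"
  shows "algebra_embedding (lattice_algebra neg box dia) (fi_algebra neg box dia) (fi_hat neg)"
  unfolding algebra_embedding_def lattice_algebra_def fi_algebra_def frame_algebra_def
  using assms
  by (simp add: fi_hat_in_fixpoints inj_fi_hat fi_hat_inf fi_hat_sup fi_hat_bot fi_hat_top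
      fi_hat_neg fi_hat_box fi_hat_dia)

section \<open>Compact open fixpoints\<close>

text \<open>The generating hats are closed under binary intersection by \<open>fi_hat_inf\<close>,
  so the subbasis is already a basis.\<close>

lemma fi_topology_basis:
  assumes "openin (fi_topology neg) U" "x \<in> U"
  shows "\<exists>a. x \<in> fi_hat neg a \<and> fi_hat neg a \<subseteq> U"
proof -
  have "generate_topology_on (range (fi_hat neg)) U"
    using assms(1) by (simp add: fi_topology_def openin_topology_generated_by_iff)
  then show ?thesis using assms(2)
  proof (induction arbitrary: x rule: generate_topology_on.induct)
    case (Int A B)
    then obtain a b where "x \<in> fi_hat neg a" "fi_hat neg a \<subseteq> A" "x \<in> fi_hat neg b" "fi_hat neg b \<subseteq> B"
      by blast
    then have "x \<in> fi_hat neg (inf a b)" "fi_hat neg (inf a b) \<subseteq> A \<inter> B"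
      by (auto simp: fi_hat_inf)
    then show ?case by blast
  qed blast+
qed

lemma openin_fi_hat: "openin (fi_topology neg) (fi_hat neg a)"
  unfolding fi_topology_def by (rule topology_generated_by_Basis) simp

lemma compactin_fi_hat: "compactin (fi_topology neg) (fi_hat neg a)"
  unfolding compactin_def
proof (intro conjI allI impI)
  show "fi_hat neg a \<subseteq> topspace (fi_topology neg)"
    by (simp add: topspace_fi_topology fi_hat_subset)
next
  fix \<U> assume U: "(\<forall>U\<in>\<U>. openin (fi_topology neg) U) \<and> fi_hat neg a \<subseteq> \<Union>\<U>"
  have "({a..}, UNIV) \<in> fi_hat neg a" by (simp add: generic_point_in_fi_hat)
  with U obtain U where "U \<in> \<U>" "({a..}, UNIV) \<in> U" by blast
  \<comment> \<open>Here \<open>a \<le> b\<close>, so the single member \<open>U\<close> covers the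
    whole hat of \<open>a\<close>.\<close>
  then obtain b where "({a..}, UNIV) \<in> fi_hat neg b" "fi_hat neg b \<subseteq> U"
    using fi_topology_basis[of neg U "({a..}, UNIV)"] U by auto
  then have "fi_hat neg a \<subseteq> U"
    using fi_hat_subset_iff[of neg a b] by (simp add: generic_point_in_fi_hat)
  with \<open>U \<in> \<U>\<close> show "\<exists>\<F>. finite \<F> \<and> \<F> \<subseteq> \<U> \<and> fi_hat neg a \<subseteq> \<Union>\<F>"
    by (intro exI[of _ "{U}"]) simp
qed

section \<open>Finite unions of hats\<close>

lemma frame_closure_Un_closure:
  assumes "A \<subseteq> X" "B \<subseteq> X"
  shows "frame_closure X T (A \<union> frame_closure X T B) = frame_closure X T (A \<union> B)"
proof (rule equalityI)
  have "A \<union> B \<subseteq> frame_closure X T (A \<union> B)"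
    using assms by (intro frame_closure_increasing) simp
  then have "A \<union> frame_closure X T B \<subseteq> frame_closure X T (A \<union> B)"
    using frame_closure_mono[of B "A \<union> B" X T] by blast
  from frame_closure_mono[OF this, of X T]
  show "frame_closure X T (A \<union> frame_closure X T B) \<subseteq> frame_closure X T (A \<union> B)"
    using frame_closure_in_fixpoints[of X T "A \<union> B"] unfolding frame_fixpoints_def by simp
  show "frame_closure X T (A \<union> B) \<subseteq> frame_closure X T (A \<union> frame_closure X T B)"
    using frame_closure_increasing[OF assms(2)] by (intro frame_closure_mono) blast
qed

text \<open>Induction on \<open>S\<close>: the empty union gives the hat of \<open>bot\<close>, and
  each new element is joined to \<open>s\<close> through \<open>fi_hat_sup\<close>, after the inner
  closure has been absorbed.\<close>

lemma frame_closure_finite_Union_fi_hat: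
  assumes neg: "neg top = bot" and "finite S"
  shows "\<exists>s. frame_closure (fi_pairs neg) fi_tri (\<Union>(fi_hat neg ` S)) = fi_hat neg s"
  using \<open>finite S\<close>
proof induction
  case empty
  show ?case using fi_hat_bot[of neg, OF neg] by auto
next
  case (insert a S)
  then obtain s where "frame_closure (fi_pairs neg) fi_tri (\<Union>(fi_hat neg ` S)) = fi_hat neg s"
    by blast
  moreover have "\<Union>(fi_hat neg ` S) \<subseteq> fi_pairs neg" using fi_hat_subset by blast
  ultimately have "frame_closure (fi_pairs neg) fi_tri (\<Union>(fi_hat neg ` insert a S)) =
      fi_hat neg (sup a s)"
    using frame_closure_Un_closure[of "fi_hat neg a" "fi_pairs neg" "\<Union>(fi_hat neg ` S)" fi_tri]
    by (simp add: fi_hat_subset fi_hat_sup[of neg, OF neg])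
  then show ?case by blast
qed

lemma compact_open_fixpoints_eq:
  assumes neg: "neg top = bot"
  shows "compact_open_fixpoints neg = range (fi_hat neg)"
proof (rule equalityI)
  show "range (fi_hat neg) \<subseteq> compact_open_fixpoints neg"
    by (auto simp: compact_open_fixpoints_def fi_hat_in_fixpoints[of neg, OF neg] compactin_fi_hat openin_fi_hat)
  show "compact_open_fixpoints neg \<subseteq> range (fi_hat neg)"
  proof
    fix A assume "A \<in> compact_open_fixpoints neg"
    then have fix_A: "frame_closure (fi_pairs neg) fi_tri A = A"
      and "compactin (fi_topology neg) A" "openin (fi_topology neg) A"
      by (auto simp: compact_open_fixpoints_def frame_fixpoints_def)
    \<comment> \<open>Only hats inside \<open>A\<close> are used, so that a finite subcover has
      union exactly \<open>A\<close>, not merely a superset.\<close>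
    define \<U> where "\<U> = fi_hat neg ` {a. fi_hat neg a \<subseteq> A}"
    have "A \<subseteq> \<Union>\<U>"
      using fi_topology_basis[OF \<open>openin (fi_topology neg) A\<close>] unfolding \<U>_def by blast
    moreover have "openin (fi_topology neg) U" if "U \<in> \<U>" for U
      using that openin_fi_hat unfolding \<U>_def by auto
    ultimately obtain \<F> where "finite \<F>" "\<F> \<subseteq> \<U>" "A \<subseteq> \<Union>\<F>"
      using compactinD[OF \<open>compactin (fi_topology neg) A\<close>, of \<U>] by blast
    then obtain S where S: "S \<subseteq> {a. fi_hat neg a \<subseteq> A}" "finite S" "\<F> = fi_hat neg ` S"
      using finite_subset_image[OF \<open>finite \<F>\<close> \<open>\<F> \<subseteq> \<U>\<close>[unfolded \<U>_def]] by blast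
    with \<open>A \<subseteq> \<Union>\<F>\<close> have "A = \<Union>(fi_hat neg ` S)" by blast
    then show "A \<in> range (fi_hat neg)"
      using frame_closure_finite_Union_fi_hat[of neg, OF neg S(2)] fix_A by auto
  qed
qed

section \<open>Image of an embedding as a subalgebra\<close>

lemma algebra_embedding_image:
  assumes "algebra_embedding A B h" "is_subuniverse (Carr A) A"
  shows "is_subuniverse (h ` Carr A) B" "algebra_isomorphism A (B\<lparr>Carr := h ` Carr A\<rparr>) h"
proof -
  have sub: "Meet A a b \<in> Carr A" "Join A a b \<in> Carr A" "Neg A a \<in> Carr A" "Box A a \<in> Carr A"
    "Dia A a \<in> Carr A" "Zero A \<in> Carr A" "One A \<in> Carr A"
    if "a \<in> Carr A" "b \<in> Carr A" for a b
    using assms(2) that unfolding is_subuniverse_def by simp_all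
  have hom: "Meet B (h a) (h b) = h (Meet A a b)" "Join B (h a) (h b) = h (Join A a b)"
    "Neg B (h a) = h (Neg A a)" "Box B (h a) = h (Box A a)" "Dia B (h a) = h (Dia A a)"
    "Zero B = h (Zero A)" "One B = h (One A)"
    if "a \<in> Carr A" "b \<in> Carr A" for a b
    using assms(1) that unfolding algebra_embedding_def by simp_all
  have "Zero A \<in> Carr A" using assms(2) unfolding is_subuniverse_def by simp
  moreover have "h ` Carr A \<subseteq> Carr B" using assms(1) unfolding algebra_embedding_def by blast
  ultimately show "is_subuniverse (h ` Carr A) B"
    unfolding is_subuniverse_def by (auto simp: hom intro!: imageI sub)
  \<comment> \<open>The update keeps the operations of \<open>B\<close> and makes the image the
    carrier, so surjectivity is immediate.\<close>
  show "algebra_isomorphism A (B\<lparr>Carr := h ` Carr A\<rparr>) h"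
    using assms(1) unfolding algebra_isomorphism_def algebra_embedding_def by simp
qed

theorem theorem3p10:
  fixes neg box dia :: "'a::bounded_lattice \<Rightarrow> 'a"
  assumes "antimono neg" and "neg top = bot"
    and "multiplicative_op box"
    and "additive_op dia"
  shows "additive_modal_frame (fi_pairs neg) fi_tri (fi_R box) (fi_Q dia) \<and>
    (\<exists>h. algebra_embedding (lattice_algebra neg box dia) (fi_algebra neg box dia) h) \<and>
    is_subuniverse (compact_open_fixpoints neg) (fi_algebra neg box dia) \<and>
    (\<exists>h. algebra_isomorphism (lattice_algebra neg box dia)
      ((fi_algebra neg box dia)\<lparr>Carr := compact_open_fixpoints neg\<rparr>) h)"
proof -
  have emb: "algebra_embedding (lattice_algebra neg box dia) (fi_algebra neg box dia) (fi_hat neg)"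
    by (rule fi_hat_embedding[of neg, OF assms])
  have "is_subuniverse (Carr (lattice_algebra neg box dia)) (lattice_algebra neg box dia)"
    by (simp add: is_subuniverse_def lattice_algebra_def)
  \<comment> \<open>The hat map witnesses both existential claims; its image is identified next with
    the compact open fixpoints.\<close>
  note image = algebra_embedding_image[OF emb this]
  have "fi_hat neg ` Carr (lattice_algebra neg box dia) = compact_open_fixpoints neg"
    by (simp add: compact_open_fixpoints_eq[of neg, OF assms(2)] lattice_algebra_def)
  with image additive_modal_frame_fi_pairs[of neg, OF assms(2-4)] emb show ?thesis by auto
qed

thm_deps theorem3p10

end
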